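(* Let $G$ be a group and $\theta:G\to G$ an endomorphism. Then the Bruck--Reilly extension $\mathrm{BR}(G,\theta)$ is coherent, i.e. both right coherent and left coherent.
   Context: For a monoid $M$ and an endomorphism $\theta:M\to M$, the Bruck--Reilly extension $\mathrm{BR}(M,\theta)$ is the monoid with underlying set $\mathbb{N}_0\times M\times\mathbb{N}_0$ (where $\mathbb{N}_0=\{0,1,2,\dots\}$) and multiplication \[(a,g,b)(c,h,d)=\bigl(a-b+t,\ (g\theta^{t-b})(h\theta^{t-c}),\ d-c+t\bigr),\qquad t=\max\{b,c\},\] where maps are written on the right and $\theta^0$ is the identity map. Let $S$ be a monoid. A right $S$-act is a set $A$ with a map $A\times S\to A$, $(a,s)\mapsto as$, with $a1=a$ and $a(st)=(as)t$. The free right $S$-act on a set $X$ is $F_S(X)=X\times S$ with $(x,s)t=(x,st)$. A congruence on a right $S$-act is an equivalence relation preserved by the action; it is finitely generated if it is the smallest congruence containing some finite set of pairs. An act $A$ is finitely generated if $A=a_1S\cup\dots\cup a_nS$ for some $a_i\in A$, and finitely presented if it is isomorphic to $F_S(X)/\rho$ with $X$ finite and $\rho$ a finitely generated congruence. The empty set is allowed as a subact (and is finitely generated). The monoid $S$ is right coherent if every finitely generated subact of every finitely presented right $S$-act is finitely presented. Left coherent is defined dually, using left $S$-acts. *)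

theory Defs
  imports "HOL-Algebra.Group"
begin

text \<open>The multiplication of the Bruck--Reilly extension is
  \<open>(a, g, b)(c, h, d) = (a - b + t, g\<theta>\<^sup>t\<^sup>-\<^sup>b h\<theta>\<^sup>t\<^sup>-\<^sup>c, d - c + t)\<close> with \<open>t = max b c\<close>.  The subtractions are
  regrouped as \<open>t - b\<close> and \<open>t - c\<close>, since \<open>a - b\<close> and \<open>d - c\<close> would truncate on \<^typ>\<open>nat\<close>.\<close>

definition Bruck_Reilly :: "('g, 'm) monoid_scheme \<Rightarrow> ('g \<Rightarrow> 'g) \<Rightarrow> (nat \<times> 'g \<times> nat) monoid" where
  "Bruck_Reilly M \<theta> =
     \<lparr>carrier = UNIV \<times> carrier M \<times> UNIV,
      mult = (\<lambda>(a, g, b) (c, h, d). let t = max b c in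
                (a + (t - b), (\<theta> ^^ (t - b)) g \<otimes>\<^bsub>M\<^esub> (\<theta> ^^ (t - c)) h, d + (t - c))),
      one = (0, \<one>\<^bsub>M\<^esub>, 0)\<rparr>"

lemma monoid_Bruck_Reilly:
  assumes "monoid M" "\<theta> \<in> hom M M" "\<theta> \<one>\<^bsub>M\<^esub> = \<one>\<^bsub>M\<^esub>"
  shows "monoid (Bruck_Reilly M \<theta>)"
proof -
  interpret monoid M by fact
  have closed: "(\<theta> ^^ n) g \<in> carrier M" if "g \<in> carrier M" for n g
    using that assms(2) by (induction n) (auto simp: hom_def Pi_def)
  have mult: "(\<theta> ^^ n) (g \<otimes>\<^bsub>M\<^esub> h) = (\<theta> ^^ n) g \<otimes>\<^bsub>M\<^esub> (\<theta> ^^ n) h"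
    if "g \<in> carrier M" "h \<in> carrier M" for n g h
    using that assms(2) closed by (induction n) (auto simp: hom_def)
  have one: "(\<theta> ^^ n) \<one>\<^bsub>M\<^esub> = \<one>\<^bsub>M\<^esub>" for n
    using assms(3) by (induction n) auto
  have pow: "(\<theta> ^^ m) ((\<theta> ^^ n) g) = (\<theta> ^^ (m + n)) g" for m n g
    by (simp add: funpow_add)
  have assoc: "x \<otimes>\<^bsub>Bruck_Reilly M \<theta>\<^esub> y \<otimes>\<^bsub>Bruck_Reilly M \<theta>\<^esub> z
      = x \<otimes>\<^bsub>Bruck_Reilly M \<theta>\<^esub> (y \<otimes>\<^bsub>Bruck_Reilly M \<theta>\<^esub> z)"
    if xyz: "x \<in> carrier (Bruck_Reilly M \<theta>)" "y \<in> carrier (Bruck_Reilly M \<theta>)"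
      "z \<in> carrier (Bruck_Reilly M \<theta>)" for x y z
  proof -
    obtain a g b where x: "x = (a, g, b)" by (cases x)
    obtain c h d where y: "y = (c, h, d)" by (cases y)
    obtain e k f where z: "z = (e, k, f)" by (cases z)
    have gs: "g \<in> carrier M" "h \<in> carrier M" "k \<in> carrier M"
      using xyz by (auto simp: Bruck_Reilly_def x y z)
    let ?t = "max b c" and ?u = "max d e"
    let ?v = "max (d + (?t - c)) e" and ?w = "max b (c + (?u - d))"
    have eqs: "a + (?t - b) + (?v - (d + (?t - c))) = a + (?w - b)"
      "?v - (d + (?t - c)) + (?t - b) = ?w - b"
      "?v - (d + (?t - c)) + (?t - c) = ?w - (c + (?u - d)) + (?u - d)"
      "?v - e = ?w - (c + (?u - d)) + (?u - e)"
      "f + (?w - (c + (?u - d)) + (?u - e)) = f + (?u - e) + (?w - (c + (?u - d)))"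
      by (auto simp: max_def)
    show ?thesis
      unfolding x y z
      by (simp only: Bruck_Reilly_def monoid.simps partial_object.simps prod.case Let_def
          mult closed gs m_closed pow eqs m_assoc)
  qed
  show ?thesis
  proof (rule monoidI)
    show "x \<otimes>\<^bsub>Bruck_Reilly M \<theta>\<^esub> y \<in> carrier (Bruck_Reilly M \<theta>)"
      if "x \<in> carrier (Bruck_Reilly M \<theta>)" "y \<in> carrier (Bruck_Reilly M \<theta>)" for x y
      using that closed by (auto simp: Bruck_Reilly_def Let_def)
  qed (use assoc closed one in \<open>auto simp: Bruck_Reilly_def Let_def\<close>)
qed


locale right_act = monoid S for S (structure) +
  fixes A :: "'x set" and act :: "'x \<Rightarrow> 'a \<Rightarrow> 'x"
  assumes act_closed: "\<lbrakk>x \<in> A; s \<in> carrier S\<rbrakk> \<Longrightarrow> act x s \<in> A"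
    and act_one: "x \<in> A \<Longrightarrow> act x \<one> = x"
    and act_mult: "\<lbrakk>x \<in> A; s \<in> carrier S; t \<in> carrier S\<rbrakk> \<Longrightarrow> act x (s \<otimes> t) = act (act x s) t"

definition right_subact ::
    "('s, 'm) monoid_scheme \<Rightarrow> 'x set \<Rightarrow> 'x set \<Rightarrow> ('x \<Rightarrow> 's \<Rightarrow> 'x) \<Rightarrow> bool" where
  "right_subact S B A act \<longleftrightarrow> B \<subseteq> A \<and> (\<forall>x\<in>B. \<forall>s\<in>carrier S. act x s \<in> B)"

definition fg_right_act ::
    "('s, 'm) monoid_scheme \<Rightarrow> 'x set \<Rightarrow> ('x \<Rightarrow> 's \<Rightarrow> 'x) \<Rightarrow> bool" where
  "fg_right_act S A act \<longleftrightarrow>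
     (\<exists>F. finite F \<and> F \<subseteq> A \<and> A = (\<Union>x\<in>F. (\<lambda>s. act x s) ` carrier S))"

definition right_congruence ::
    "('s, 'm) monoid_scheme \<Rightarrow> 'x set \<Rightarrow> ('x \<Rightarrow> 's \<Rightarrow> 'x) \<Rightarrow> ('x \<times> 'x) set \<Rightarrow> bool" where
  "right_congruence S A act \<rho> \<longleftrightarrow>
     equiv A \<rho> \<and> (\<forall>(x, y)\<in>\<rho>. \<forall>s\<in>carrier S. (act x s, act y s) \<in> \<rho>)"

definition fg_right_congruence ::
    "('s, 'm) monoid_scheme \<Rightarrow> 'x set \<Rightarrow> ('x \<Rightarrow> 's \<Rightarrow> 'x) \<Rightarrow> ('x \<times> 'x) set \<Rightarrow> bool" where
  "fg_right_congruence S A act \<rho> \<longleftrightarrow> right_congruence S A act \<rho> \<and>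
     (\<exists>R. finite R \<and> R \<subseteq> \<rho> \<and> (\<forall>\<sigma>. right_congruence S A act \<sigma> \<and> R \<subseteq> \<sigma> \<longrightarrow> \<rho> \<subseteq> \<sigma>))"

definition free_right_carrier :: "('s, 'm) monoid_scheme \<Rightarrow> 'x set \<Rightarrow> ('x \<times> 's) set" where
  "free_right_carrier S X = X \<times> carrier S"

definition free_right_action :: "('s, 'm) monoid_scheme \<Rightarrow> 'x \<times> 's \<Rightarrow> 's \<Rightarrow> 'x \<times> 's" where
  "free_right_action S = (\<lambda>(x, s) t. (x, s \<otimes>\<^bsub>S\<^esub> t))"

text \<open>On a congruence class \<open>C\<close> the union below is the class of \<open>act x s\<close> for any \<open>x \<in> C\<close>.\<close>

definition quotient_right_action ::
    "('x \<Rightarrow> 's \<Rightarrow> 'x) \<Rightarrow> ('x \<times> 'x) set \<Rightarrow> 'x set \<Rightarrow> 's \<Rightarrow> 'x set" where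
  "quotient_right_action act \<rho> C s = (\<Union>x\<in>C. \<rho> `` {act x s})"

definition right_act_iso ::
    "('s, 'm) monoid_scheme \<Rightarrow> 'x set \<Rightarrow> ('x \<Rightarrow> 's \<Rightarrow> 'x) \<Rightarrow> 'y set \<Rightarrow> ('y \<Rightarrow> 's \<Rightarrow> 'y) \<Rightarrow> bool" where
  "right_act_iso S A act B act' \<longleftrightarrow>
     (\<exists>\<phi>. bij_betw \<phi> A B \<and> (\<forall>x\<in>A. \<forall>s\<in>carrier S. \<phi> (act x s) = act' (\<phi> x) s))"

text \<open>Every finite set is in bijection with a set of natural numbers, so it is no restriction to
  take the finite set of free generators inside \<^typ>\<open>nat\<close>.\<close>

definition fp_right_act ::
    "('s, 'm) monoid_scheme \<Rightarrow> 'x set \<Rightarrow> ('x \<Rightarrow> 's \<Rightarrow> 'x) \<Rightarrow> bool" where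
  "fp_right_act S A act \<longleftrightarrow> right_act S A act \<and>
     (\<exists>(X :: nat set) \<rho>. finite X \<and>
        fg_right_congruence S (free_right_carrier S X) (free_right_action S) \<rho> \<and>
        right_act_iso S A act
          (free_right_carrier S X // \<rho>) (quotient_right_action (free_right_action S) \<rho>))"

text \<open>A definition cannot quantify over all types, so the type in which the acts live is a parameter.
  Coherence in the usual sense is coherence for every type \<open>'x\<close>: a theorem about
  \<open>right_coherent TYPE('x) S\<close> with \<open>'x\<close> a type variable asserts just that.\<close>

definition right_coherent :: "'x itself \<Rightarrow> ('s, 'm) monoid_scheme \<Rightarrow> bool" where
  "right_coherent _ S \<longleftrightarrow>
     (\<forall>(A :: 'x set) act B. fp_right_act S A act \<and> right_subact S B A act \<and> fg_right_act S B act
        \<longrightarrow> fp_right_act S B act)"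


locale left_act = monoid S for S (structure) +
  fixes A :: "'x set" and act :: "'a \<Rightarrow> 'x \<Rightarrow> 'x"
  assumes act_closed: "\<lbrakk>x \<in> A; s \<in> carrier S\<rbrakk> \<Longrightarrow> act s x \<in> A"
    and act_one: "x \<in> A \<Longrightarrow> act \<one> x = x"
    and act_mult: "\<lbrakk>x \<in> A; s \<in> carrier S; t \<in> carrier S\<rbrakk> \<Longrightarrow> act (s \<otimes> t) x = act s (act t x)"

definition left_subact ::
    "('s, 'm) monoid_scheme \<Rightarrow> 'x set \<Rightarrow> 'x set \<Rightarrow> ('s \<Rightarrow> 'x \<Rightarrow> 'x) \<Rightarrow> bool" where
  "left_subact S B A act \<longleftrightarrow> B \<subseteq> A \<and> (\<forall>x\<in>B. \<forall>s\<in>carrier S. act s x \<in> B)"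

definition fg_left_act ::
    "('s, 'm) monoid_scheme \<Rightarrow> 'x set \<Rightarrow> ('s \<Rightarrow> 'x \<Rightarrow> 'x) \<Rightarrow> bool" where
  "fg_left_act S A act \<longleftrightarrow>
     (\<exists>F. finite F \<and> F \<subseteq> A \<and> A = (\<Union>x\<in>F. (\<lambda>s. act s x) ` carrier S))"

definition left_congruence ::
    "('s, 'm) monoid_scheme \<Rightarrow> 'x set \<Rightarrow> ('s \<Rightarrow> 'x \<Rightarrow> 'x) \<Rightarrow> ('x \<times> 'x) set \<Rightarrow> bool" where
  "left_congruence S A act \<rho> \<longleftrightarrow>
     equiv A \<rho> \<and> (\<forall>(x, y)\<in>\<rho>. \<forall>s\<in>carrier S. (act s x, act s y) \<in> \<rho>)"

definition fg_left_congruence ::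
    "('s, 'm) monoid_scheme \<Rightarrow> 'x set \<Rightarrow> ('s \<Rightarrow> 'x \<Rightarrow> 'x) \<Rightarrow> ('x \<times> 'x) set \<Rightarrow> bool" where
  "fg_left_congruence S A act \<rho> \<longleftrightarrow> left_congruence S A act \<rho> \<and>
     (\<exists>R. finite R \<and> R \<subseteq> \<rho> \<and> (\<forall>\<sigma>. left_congruence S A act \<sigma> \<and> R \<subseteq> \<sigma> \<longrightarrow> \<rho> \<subseteq> \<sigma>))"

definition free_left_carrier :: "('s, 'm) monoid_scheme \<Rightarrow> 'x set \<Rightarrow> ('s \<times> 'x) set" where
  "free_left_carrier S X = carrier S \<times> X"

definition free_left_action :: "('s, 'm) monoid_scheme \<Rightarrow> 's \<Rightarrow> 's \<times> 'x \<Rightarrow> 's \<times> 'x" where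
  "free_left_action S = (\<lambda>t (s, x). (t \<otimes>\<^bsub>S\<^esub> s, x))"

definition quotient_left_action ::
    "('s \<Rightarrow> 'x \<Rightarrow> 'x) \<Rightarrow> ('x \<times> 'x) set \<Rightarrow> 's \<Rightarrow> 'x set \<Rightarrow> 'x set" where
  "quotient_left_action act \<rho> s C = (\<Union>x\<in>C. \<rho> `` {act s x})"

definition left_act_iso ::
    "('s, 'm) monoid_scheme \<Rightarrow> 'x set \<Rightarrow> ('s \<Rightarrow> 'x \<Rightarrow> 'x) \<Rightarrow> 'y set \<Rightarrow> ('s \<Rightarrow> 'y \<Rightarrow> 'y) \<Rightarrow> bool" where
  "left_act_iso S A act B act' \<longleftrightarrow>
     (\<exists>\<phi>. bij_betw \<phi> A B \<and> (\<forall>x\<in>A. \<forall>s\<in>carrier S. \<phi> (act s x) = act' s (\<phi> x)))"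

definition fp_left_act ::
    "('s, 'm) monoid_scheme \<Rightarrow> 'x set \<Rightarrow> ('s \<Rightarrow> 'x \<Rightarrow> 'x) \<Rightarrow> bool" where
  "fp_left_act S A act \<longleftrightarrow> left_act S A act \<and>
     (\<exists>(X :: nat set) \<rho>. finite X \<and>
        fg_left_congruence S (free_left_carrier S X) (free_left_action S) \<rho> \<and>
        left_act_iso S A act
          (free_left_carrier S X // \<rho>) (quotient_left_action (free_left_action S) \<rho>))"

definition left_coherent :: "'x itself \<Rightarrow> ('s, 'm) monoid_scheme \<Rightarrow> bool" where
  "left_coherent _ S \<longleftrightarrow>
     (\<forall>(A :: 'x set) act B. fp_left_act S A act \<and> left_subact S B A act \<and> fg_left_act S B act
        \<longrightarrow> fp_left_act S B act)"

end

theory Submission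
  imports Defs
begin

text \<open>In \<open>BR(G, \<theta>)\<close> every nonempty right ideal is \<open>dS\<close> for a left cancellable \<open>d\<close>, namely
  \<open>d = (n, 1, 0)\<close> with \<open>n\<close> the least first coordinate occurring in the ideal, and any monoid \<open>S\<close> with
  this property is right coherent.  Indeed, let \<open>h : F \<rightarrow> A\<close> be a finite presentation and let
  \<open>h' : F' \<rightarrow> B\<close> map a free act of finite rank onto a subact \<open>B\<close> of \<open>A\<close>.  The property makes
  \<open>h\<^sup>-\<^sup>1(B)\<close> a free act, so \<open>h\<close> lifts on it to an equivariant \<open>N : h\<^sup>-\<^sup>1(B) \<rightarrow> F'\<close> with \<open>h' N = h\<close>.  A
  finite set of relations for \<open>B\<close> is given by the pairs \<open>(N(Pk), N(Qk))\<close>, one for every defining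
  relation \<open>(P, Q)\<close> of \<open>A\<close>, where \<open>kS = {s. h(Ps) \<in> B}\<close>, and by the pairs \<open>(b, N c)\<close>, one for every
  free generator \<open>b\<close> of \<open>F'\<close>, where \<open>h c = h' b\<close>.  The opposite monoid of \<open>BR(G, \<theta>)\<close>
  has the same property, with \<open>d = (0, 1, n)\<close>, which gives left coherence.\<close>

section \<open>Finite presentations as equivariant surjections with finitely generated
  kernel\<close>

definition kernel_on :: "'f set \<Rightarrow> ('f \<Rightarrow> 'x) \<Rightarrow> ('f \<times> 'f) set" where
  "kernel_on F h = {(x, y) \<in> F \<times> F. h x = h y}"

text \<open>For \<open>F\<close> free of finite rank this is a finite presentation of
  \<open>A\<close>, stated through a map so that no quotient set has to be handled. \<open>F\<close>
  is arbitrary, so that a presentation can be moved between different encodings of a free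
  act.\<close>

definition presents ::
    "('s, 'm) monoid_scheme \<Rightarrow> 'f set \<Rightarrow> ('f \<Rightarrow> 's \<Rightarrow> 'f) \<Rightarrow> 'x set \<Rightarrow> ('x \<Rightarrow> 's \<Rightarrow> 'x) \<Rightarrow> ('f \<Rightarrow> 'x) \<Rightarrow> bool" where
  "presents S F f A act h \<longleftrightarrow> h ` F = A \<and> (\<forall>x\<in>F. \<forall>s\<in>carrier S. h (f x s) = act (h x) s) \<and>
     (\<exists>R. finite R \<and> R \<subseteq> kernel_on F h \<and>
        (\<forall>\<sigma>. right_congruence S F f \<sigma> \<and> R \<subseteq> \<sigma> \<longrightarrow> kernel_on F h \<subseteq> \<sigma>))"

lemma presentsI:
  assumes "h ` F = A" and "\<And>x s. x \<in> F \<Longrightarrow> s \<in> carrier S \<Longrightarrow> h (f x s) = act (h x) s"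
    and "finite R" "R \<subseteq> kernel_on F h"
    and "\<And>\<sigma>. right_congruence S F f \<sigma> \<Longrightarrow> R \<subseteq> \<sigma> \<Longrightarrow> kernel_on F h \<subseteq> \<sigma>"
  shows "presents S F f A act h"
  unfolding presents_def using assms by (intro conjI ballI exI[of _ R] allI impI) (blast | simp)+

lemma presentsE:
  assumes "presents S F f A act h"
  obtains R where "finite R" "R \<subseteq> kernel_on F h"
    and "\<forall>\<sigma>. right_congruence S F f \<sigma> \<and> R \<subseteq> \<sigma> \<longrightarrow> kernel_on F h \<subseteq> \<sigma>"
proof -
  from assms have "\<exists>R. finite R \<and> R \<subseteq> kernel_on F h \<and>
      (\<forall>\<sigma>. right_congruence S F f \<sigma> \<and> R \<subseteq> \<sigma> \<longrightarrow> kernel_on F h \<subseteq> \<sigma>)"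
    by (simp add: presents_def)
  then show thesis by (elim exE conjE) (rule that)
qed

lemma right_congruence_kernel:
  assumes "\<And>x s. x \<in> F \<Longrightarrow> s \<in> carrier S \<Longrightarrow> f x s \<in> F"
    and "\<And>x s. x \<in> F \<Longrightarrow> s \<in> carrier S \<Longrightarrow> h (f x s) = act (h x) s"
  shows "right_congruence S F f (kernel_on F h)"
  unfolding right_congruence_def kernel_on_def
  by (auto simp: assms intro!: equivI refl_onI symI transI)

text \<open>Compatibility of \<open>\<rho>\<close> with the action puts every \<open>f y s\<close>,
  for \<open>y\<close> in the class of \<open>x\<close>, into one class, so the union in the
  quotient action collapses to it.\<close>

lemma quotient_right_action_class:
  assumes "right_congruence S F f \<rho>" "\<And>x s. x \<in> F \<Longrightarrow> s \<in> carrier S \<Longrightarrow> f x s \<in> F"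
    and "x \<in> F" "s \<in> carrier S"
  shows "quotient_right_action f \<rho> (\<rho> `` {x}) s = \<rho> `` {f x s}"
proof -
  have eq: "equiv F \<rho>" using assms(1) by (simp add: right_congruence_def)
  have "\<rho> `` {f y s} = \<rho> `` {f x s}" if "y \<in> \<rho> `` {x}" for y
    using that assms(1,4) equiv_class_eq[OF eq] by (fastforce simp: right_congruence_def)
  moreover have "x \<in> \<rho> `` {x}" using eq assms(3) by (rule equiv_class_self)
  ultimately show ?thesis unfolding quotient_right_action_def by blast
qed

text \<open>The first isomorphism theorem: a surjection \<open>h\<close> yields its kernel as
  \<open>\<rho>\<close>, and conversely an isomorphism onto a quotient, inverted after the
  projection to classes, yields \<open>h\<close>.\<close>

lemma presents_iff_quotient:
  assumes F: "\<And>x s. x \<in> F \<Longrightarrow> s \<in> carrier S \<Longrightarrow> f x s \<in> F"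
    and A: "\<And>x s. x \<in> A \<Longrightarrow> s \<in> carrier S \<Longrightarrow> act x s \<in> A"
  shows "(\<exists>h. presents S F f A act h) \<longleftrightarrow>
    (\<exists>\<rho>. fg_right_congruence S F f \<rho> \<and> right_act_iso S A act (F // \<rho>) (quotient_right_action f \<rho>))"
proof
  assume "\<exists>h. presents S F f A act h"
  then obtain h where h: "presents S F f A act h" ..
  then have onto: "h ` F = A"
    and hom: "\<And>x s. x \<in> F \<Longrightarrow> s \<in> carrier S \<Longrightarrow> h (f x s) = act (h x) s"
    by (simp_all add: presents_def)
  define \<rho> where "\<rho> = kernel_on F h"
  have cong: "right_congruence S F f \<rho>"
    unfolding \<rho>_def by (rule right_congruence_kernel) (use F hom in auto)
  have cls: "\<rho> `` {x} = {y \<in> F. h y = h x}" if "x \<in> F" for x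
    using that by (auto simp: \<rho>_def kernel_on_def)
  \<comment> \<open>The fibre of \<open>h\<close> over \<open>a\<close>. Fibres are the kernel
    classes, so \<open>\<phi>\<close> inverts the map that \<open>h\<close> induces on
    \<open>F // \<rho>\<close>.\<close>
  define \<phi> where "\<phi> a = {y \<in> F. h y = a}" for a
  have "bij_betw \<phi> A (F // \<rho>)"
    unfolding bij_betw_def
  proof
    show "inj_on \<phi> A" using onto by (fastforce simp: inj_on_def \<phi>_def)
    have "F // \<rho> = (\<lambda>x. \<phi> (h x)) ` F"
      using cls by (auto simp: quotient_def \<phi>_def)
    then show "\<phi> ` A = F // \<rho>" using onto by (simp flip: onto add: image_image)
  qed
  moreover have "\<phi> (act a s) = quotient_right_action f \<rho> (\<phi> a) s"
    if "a \<in> A" "s \<in> carrier S" for a s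
  proof -
    obtain x where x: "x \<in> F" "a = h x" using onto \<open>a \<in> A\<close> by blast
    then have "\<phi> a = \<rho> `` {x}" using cls by (simp add: \<phi>_def)
    then show ?thesis
      using quotient_right_action_class[OF cong F x(1) that(2)] cls[OF F[OF x(1) that(2)]]
        hom[OF x(1) that(2)] x by (simp add: \<phi>_def)
  qed
  ultimately have "right_act_iso S A act (F // \<rho>) (quotient_right_action f \<rho>)"
    unfolding right_act_iso_def by blast
  moreover have "fg_right_congruence S F f \<rho>"
    using cong h by (simp add: fg_right_congruence_def \<rho>_def presents_def)
  ultimately show "\<exists>\<rho>. fg_right_congruence S F f \<rho> \<and>
      right_act_iso S A act (F // \<rho>) (quotient_right_action f \<rho>)" by blast
next
  assume "\<exists>\<rho>. fg_right_congruence S F f \<rho> \<and> right_act_iso S A act (F // \<rho>) (quotient_right_action f \<rho>)"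
  then obtain \<rho> \<phi> where fg: "fg_right_congruence S F f \<rho>" and bij: "bij_betw \<phi> A (F // \<rho>)"
    and hom: "\<And>x s. x \<in> A \<Longrightarrow> s \<in> carrier S \<Longrightarrow> \<phi> (act x s) = quotient_right_action f \<rho> (\<phi> x) s"
    unfolding right_act_iso_def by blast
  have cong: "right_congruence S F f \<rho>" and eq: "equiv F \<rho>"
    using fg by (auto simp: fg_right_congruence_def right_congruence_def)
  define h where "h x = inv_into A \<phi> (\<rho> `` {x})" for x
  have hA: "h x \<in> A" and \<phi>h: "\<phi> (h x) = \<rho> `` {x}" if "x \<in> F" for x
  proof -
    have "\<rho> `` {x} \<in> \<phi> ` A" using bij that by (auto simp: bij_betw_def intro: quotientI)
    then show "h x \<in> A" "\<phi> (h x) = \<rho> `` {x}"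
      by (auto simp: h_def inv_into_into f_inv_into_f)
  qed
  have inj: "a = b" if "a \<in> A" "b \<in> A" "\<phi> a = \<phi> b" for a b
    using bij that by (auto simp: bij_betw_def inj_on_def)
  \<comment> \<open>Once the kernel is \<open>\<rho>\<close> itself, a finite generating set of
    \<open>\<rho>\<close> serves \<open>presents\<close> as it stands.\<close>
  have ker: "kernel_on F h = \<rho>"
  proof -
    have "h x = h y \<longleftrightarrow> (x, y) \<in> \<rho>" if "x \<in> F" "y \<in> F" for x y
      using that eq_equiv_class_iff[OF eq that] \<phi>h inj[OF hA hA] by metis
    moreover have "\<rho> \<subseteq> F \<times> F" using eq by (simp add: equiv_def refl_on_def)
    ultimately show ?thesis unfolding kernel_on_def by blast
  qed
  have "h ` F = A"
  proof
    show "A \<subseteq> h ` F"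
    proof
      fix a assume a: "a \<in> A"
      then have "\<phi> a \<in> F // \<rho>" using bij by (auto simp: bij_betw_def)
      then obtain x where x: "x \<in> F" "\<phi> a = \<rho> `` {x}" by (auto elim: quotientE)
      then have "a = h x" using inj[OF a hA[OF x(1)]] \<phi>h by simp
      then show "a \<in> h ` F" using x by blast
    qed
  qed (use hA in blast)
  moreover have "h (f x s) = act (h x) s" if "x \<in> F" "s \<in> carrier S" for x s
  proof (rule inj)
    show "\<phi> (h (f x s)) = \<phi> (act (h x) s)"
      using that quotient_right_action_class[OF cong F that] by (simp add: hom hA \<phi>h F)
  qed (use that hA A F in auto)
  ultimately have "presents S F f A act h"
    using fg unfolding presents_def ker fg_right_congruence_def by simp
  then show "\<exists>h. presents S F f A act h" by blast
qed

text \<open>Both the relations and the congruences are carried along \<open>b\<close>. This is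
  needed to exchange the two coordinates of a free act when sides are switched.\<close>

lemma presents_bij:
  assumes p: "presents S F f A act h" and bij: "bij_betw b F' F"
    and eqv: "\<And>x s. x \<in> F' \<Longrightarrow> s \<in> carrier S \<Longrightarrow> b (f' x s) = f (b x) s"
    and F': "\<And>x s. x \<in> F' \<Longrightarrow> s \<in> carrier S \<Longrightarrow> f' x s \<in> F'"
  shows "presents S F' f' A act (h \<circ> b)"
proof -
  have onto: "h ` F = A"
    and hom: "\<And>x s. x \<in> F \<Longrightarrow> s \<in> carrier S \<Longrightarrow> h (f x s) = act (h x) s"
    using p by (simp_all add: presents_def)
  obtain R where R: "finite R" "R \<subseteq> kernel_on F h"
    and min: "\<forall>\<sigma>. right_congruence S F f \<sigma> \<and> R \<subseteq> \<sigma> \<longrightarrow> kernel_on F h \<subseteq> \<sigma>"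
    using p by (rule presentsE)
  have img: "b ` F' = F" and inj: "inj_on b F'" using bij by (auto simp: bij_betw_def)
  let ?g = "inv_into F' b"
  define R' where "R' = map_prod ?g ?g ` R"
  have g: "?g x \<in> F'" "b (?g x) = x" if "x \<in> F" for x
    using that img by (auto simp: inv_into_into f_inv_into_f)
  have "R' \<subseteq> kernel_on F' (h \<circ> b)"
  proof
    fix w assume "w \<in> R'"
    then obtain x y where "(x, y) \<in> R" and w: "w = (?g x, ?g y)" by (auto simp: R'_def)
    then have "x \<in> F" "y \<in> F" "h x = h y" using R(2) by (auto simp: kernel_on_def)
    then show "w \<in> kernel_on F' (h \<circ> b)" using g by (simp add: w kernel_on_def)
  qed
  moreover have "kernel_on F' (h \<circ> b) \<subseteq> \<sigma>'"
    if \<sigma>': "right_congruence S F' f' \<sigma>'" "R' \<subseteq> \<sigma>'" for \<sigma>'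
  proof -
    \<comment> \<open>The image of \<open>\<sigma>'\<close> under \<open>b\<close>: a congruence on
      \<open>F\<close> containing \<open>R\<close>, so that minimality of the kernel of
      \<open>h\<close> applies to it.\<close>
    define \<sigma> where "\<sigma> = {(x, y) \<in> F \<times> F. (?g x, ?g y) \<in> \<sigma>'}"
    have gf: "?g (f x s) = f' (?g x) s" if "x \<in> F" "s \<in> carrier S" for x s
      using that eqv[of "?g x" s] g F' inv_into_f_f[OF inj, of "f' (?g x) s"] by simp
    \<comment> \<open>Closure of \<open>F\<close> under \<open>f\<close> is inherited from
      \<open>F'\<close> through the equivariant bijection.\<close>
    have fF: "f x s \<in> F" if "x \<in> F" "s \<in> carrier S" for x s
      using that eqv[of "?g x" s] g[OF that(1)] F'[of "?g x" s] img imageI[of "f' (?g x) s" F' b] by simp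
    have eq: "equiv F' \<sigma>'" and act: "\<And>x y s. (x, y) \<in> \<sigma>' \<Longrightarrow> s \<in> carrier S \<Longrightarrow> (f' x s, f' y s) \<in> \<sigma>'"
      using \<sigma>'(1) by (auto simp: right_congruence_def)
    have "equiv F \<sigma>"
    proof (intro equivI refl_onI symI transI)
      show "\<sigma> \<subseteq> F \<times> F" by (auto simp: \<sigma>_def)
      show "(x, x) \<in> \<sigma>" if "x \<in> F" for x
        using that g eq by (simp add: \<sigma>_def equiv_def refl_on_def)
      show "(y, x) \<in> \<sigma>" if "(x, y) \<in> \<sigma>" for x y
        using that eq by (auto simp: \<sigma>_def equiv_def dest: symD)
      show "(x, z) \<in> \<sigma>" if "(x, y) \<in> \<sigma>" "(y, z) \<in> \<sigma>" for x y z
        using that eq by (auto simp: \<sigma>_def equiv_def dest: transD)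
    qed
    moreover have "(f x s, f y s) \<in> \<sigma>" if "(x, y) \<in> \<sigma>" "s \<in> carrier S" for x y s
    proof -
      have "x \<in> F" "y \<in> F" "(?g x, ?g y) \<in> \<sigma>'" using that(1) by (auto simp: \<sigma>_def)
      then show ?thesis using act[of "?g x" "?g y"] gf fF that(2) by (simp add: \<sigma>_def)
    qed
    ultimately have "right_congruence S F f \<sigma>" by (auto simp: right_congruence_def)
    moreover have "R \<subseteq> \<sigma>"
    proof clarify
      fix x y assume xy: "(x, y) \<in> R"
      then have "(?g x, ?g y) \<in> R'" unfolding R'_def by (rule rev_image_eqI) simp
      then show "(x, y) \<in> \<sigma>" using xy R(2) \<sigma>'(2) by (auto simp: \<sigma>_def kernel_on_def)
    qed
    ultimately have "kernel_on F h \<subseteq> \<sigma>" using min by simp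
    then have *: "(?g x, ?g y) \<in> \<sigma>'" if "x \<in> F" "y \<in> F" "h x = h y" for x y
      using that by (auto simp: \<sigma>_def kernel_on_def)
    show ?thesis
    proof clarify
      fix x y assume "(x, y) \<in> kernel_on F' (h \<circ> b)"
      then have xy: "x \<in> F'" "y \<in> F'" "h (b x) = h (b y)" by (auto simp: kernel_on_def)
      then have "b x \<in> F" "b y \<in> F" using img by blast+
      then show "(x, y) \<in> \<sigma>'" using *[OF _ _ xy(3)] xy inv_into_f_f[OF inj] by simp
    qed
  qed
  moreover have "finite R'" using R(1) by (simp add: R'_def)
  moreover have "(h \<circ> b) (f' x s) = act ((h \<circ> b) x) s" if "x \<in> F'" "s \<in> carrier S" for x s
    using that eqv hom img by auto
  moreover have "(h \<circ> b) ` F' = A" using img onto by (metis image_comp)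
  ultimately show ?thesis by (intro presentsI[of _ _ _ _ _ _ R']) simp_all
qed

lemma fp_right_act_iff_presents:
  assumes "monoid S"
  shows "fp_right_act S A act \<longleftrightarrow> right_act S A act \<and>
    (\<exists>(X :: nat set) h. finite X \<and> presents S (X \<times> carrier S) (free_right_action S) A act h)"
proof -
  interpret monoid S by fact
  have "(\<exists>\<rho>. fg_right_congruence S (X \<times> carrier S) (free_right_action S) \<rho> \<and>
        right_act_iso S A act ((X \<times> carrier S) // \<rho>)
          (quotient_right_action (free_right_action S) \<rho>)) \<longleftrightarrow>
      (\<exists>h. presents S (X \<times> carrier S) (free_right_action S) A act h)"
    if "right_act S A act" for X :: "nat set"
    by (rule presents_iff_quotient[symmetric])
      (auto simp: free_right_action_def right_act.act_closed[OF that])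
  then show ?thesis
    by (simp add: fp_right_act_def free_right_carrier_def cong: conj_cong)
qed

section \<open>Left acts as right acts over the opposite monoid\<close>

definition opposite :: "('a, 'm) monoid_scheme \<Rightarrow> 'a monoid" where
  "opposite S = \<lparr>carrier = carrier S, mult = (\<lambda>x y. y \<otimes>\<^bsub>S\<^esub> x), one = \<one>\<^bsub>S\<^esub>\<rparr>"

lemma opposite_simps [simp]:
  "carrier (opposite S) = carrier S" "x \<otimes>\<^bsub>opposite S\<^esub> y = y \<otimes>\<^bsub>S\<^esub> x" "\<one>\<^bsub>opposite S\<^esub> = \<one>\<^bsub>S\<^esub>"
  by (simp_all add: opposite_def)

lemma monoid_opposite:
  assumes "monoid S"
  shows "monoid (opposite S)"
proof -
  interpret monoid S by fact
  show ?thesis by (rule monoidI) (auto simp: m_assoc)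
qed

text \<open>Flipping arguments turns the left notions of act, congruence and isomorphism literally
  into the right ones. Only the free acts differ, with elements \<open>(s, x)\<close> against
  \<open>(x, s)\<close>; this is repaired at the level of \<open>presents\<close> by
  \<open>prod.swap\<close>.\<close>

lemma fp_left_act_iff_opposite:
  assumes "monoid S"
  shows "fp_left_act S A act \<longleftrightarrow> fp_right_act (opposite S) A (\<lambda>x s. act s x)"
proof -
  interpret monoid S by fact
  let ?T = "opposite S" and ?act = "\<lambda>x s. act s x"
  let ?fl = "\<lambda>x s. free_left_action S s x"
  have left_iff: "left_act S A act \<longleftrightarrow> right_act ?T A ?act"
    using monoid_opposite[OF assms] assms
    by (auto simp: left_act_def left_act_axioms_def right_act_def right_act_axioms_def)
  have fg: "fg_left_congruence S F f \<rho> \<longleftrightarrow> fg_right_congruence ?T F (\<lambda>x s. f s x) \<rho>"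
    for F :: "('a \<times> nat) set" and f \<rho>
    by (simp add: fg_left_congruence_def fg_right_congruence_def left_congruence_def
        right_congruence_def)
  have iso: "left_act_iso S A act B (quotient_left_action f \<rho>) \<longleftrightarrow>
      right_act_iso ?T A ?act B (quotient_right_action (\<lambda>x s. f s x) \<rho>)"
    for B and f :: "'a \<Rightarrow> 'a \<times> nat \<Rightarrow> 'a \<times> nat" and \<rho>
    by (simp add: left_act_iso_def right_act_iso_def quotient_left_action_def
        quotient_right_action_def)
  have closedl: "?fl x s \<in> carrier S \<times> X" if "x \<in> carrier S \<times> X" "s \<in> carrier ?T" for x s
    and X :: "nat set"
    using that by (auto simp: free_left_action_def)
  have swap: "(\<exists>h. presents ?T (carrier S \<times> X) ?fl A ?act h) \<longleftrightarrow>
      (\<exists>h. presents ?T (X \<times> carrier S) (free_right_action ?T) A ?act h)" for X :: "nat set"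
  proof
    assume "\<exists>h. presents ?T (carrier S \<times> X) ?fl A ?act h"
    then obtain h where h: "presents ?T (carrier S \<times> X) ?fl A ?act h" ..
    have "presents ?T (X \<times> carrier S) (free_right_action ?T) A ?act (h \<circ> prod.swap)"
      using h by (rule presents_bij)
        (auto simp: bij_betw_def free_left_action_def free_right_action_def)
    then show "\<exists>h. presents ?T (X \<times> carrier S) (free_right_action ?T) A ?act h" by blast
  next
    assume "\<exists>h. presents ?T (X \<times> carrier S) (free_right_action ?T) A ?act h"
    then obtain h where h: "presents ?T (X \<times> carrier S) (free_right_action ?T) A ?act h" ..
    have "presents ?T (carrier S \<times> X) ?fl A ?act (h \<circ> prod.swap)"
      using h by (rule presents_bij)
        (auto simp: bij_betw_def free_left_action_def free_right_action_def)
    then show "\<exists>h. presents ?T (carrier S \<times> X) ?fl A ?act h" by blast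
  qed
  have "(\<exists>\<rho>. fg_left_congruence S (carrier S \<times> X) (free_left_action S) \<rho> \<and>
        left_act_iso S A act ((carrier S \<times> X) // \<rho>) (quotient_left_action (free_left_action S) \<rho>))
      \<longleftrightarrow> (\<exists>h. presents ?T (X \<times> carrier S) (free_right_action ?T) A ?act h)"
    if "right_act ?T A ?act" for X :: "nat set"
    unfolding fg iso swap[symmetric]
    by (rule presents_iff_quotient[symmetric]) (use closedl right_act.act_closed[OF that] in auto)
  then show ?thesis
    by (simp add: fp_left_act_def left_iff fp_right_act_iff_presents[OF monoid_opposite[OF assms]]
        free_left_carrier_def cong: conj_cong)
qed

lemma left_coherent_if_opposite:
  assumes "monoid S" and "right_coherent TYPE('x) (opposite S)"
  shows "left_coherent TYPE('x) S"
  unfolding left_coherent_def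
proof (intro allI impI)
  fix A :: "'x set" and act B
  assume *: "fp_left_act S A act \<and> left_subact S B A act \<and> fg_left_act S B act"
  have "right_subact (opposite S) B A (\<lambda>x s. act s x)" "fg_right_act (opposite S) B (\<lambda>x s. act s x)"
    using * by (simp_all add: left_subact_def right_subact_def fg_left_act_def fg_right_act_def)
  then show "fp_left_act S B act"
    using * assms(2) unfolding fp_left_act_iff_opposite[OF assms(1)] right_coherent_def by blast
qed

section \<open>Monoids whose nonempty right ideals are free of rank one, and their coherence\<close>

definition free_right_ideals :: "('s, 'm) monoid_scheme \<Rightarrow> bool" where
  "free_right_ideals S \<longleftrightarrow> (\<forall>I. I \<subseteq> carrier S \<and> I \<noteq> {} \<and> (\<forall>x\<in>I. \<forall>s\<in>carrier S. x \<otimes>\<^bsub>S\<^esub> s \<in> I) \<longrightarrow>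
     (\<exists>d\<in>I. I = (\<lambda>s. d \<otimes>\<^bsub>S\<^esub> s) ` carrier S \<and> inj_on (\<lambda>s. d \<otimes>\<^bsub>S\<^esub> s) (carrier S)))"

lemma free_right_idealsE:
  assumes "free_right_ideals S" and "I \<subseteq> carrier S" "I \<noteq> {}"
    and "\<And>x s. x \<in> I \<Longrightarrow> s \<in> carrier S \<Longrightarrow> x \<otimes>\<^bsub>S\<^esub> s \<in> I"
  obtains d where "d \<in> I" "\<And>s. s \<in> I \<Longrightarrow> s \<in> (\<lambda>s. d \<otimes>\<^bsub>S\<^esub> s) ` carrier S"
    "inj_on (\<lambda>s. d \<otimes>\<^bsub>S\<^esub> s) (carrier S)"
proof -
  have "\<exists>d\<in>I. I = (\<lambda>s. d \<otimes>\<^bsub>S\<^esub> s) ` carrier S \<and> inj_on (\<lambda>s. d \<otimes>\<^bsub>S\<^esub> s) (carrier S)"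
    using assms(1)[unfolded free_right_ideals_def, rule_format, of I] assms(2-4) by simp
  then obtain d where d: "d \<in> I" "I = (\<lambda>s. d \<otimes>\<^bsub>S\<^esub> s) ` carrier S \<and> inj_on (\<lambda>s. d \<otimes>\<^bsub>S\<^esub> s) (carrier S)" ..
  show thesis
  proof (rule that[OF d(1)])
    show "s \<in> (\<lambda>s. d \<otimes>\<^bsub>S\<^esub> s) ` carrier S" if "s \<in> I" for s
      using that d(2) by (elim conjE) (rule subst)
  qed (use d in simp)
qed

lemma right_coherent_if_free_right_ideals:
  fixes S (structure)
  assumes "monoid S" and ideals: "free_right_ideals S"
  shows "right_coherent TYPE('x) S"
  unfolding right_coherent_def
proof (intro allI impI)
  fix A :: "'x set" and act B
  assume *: "fp_right_act S A act \<and> right_subact S B A act \<and> fg_right_act S B act"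
  interpret monoid S by fact
  interpret right_act S A act using * by (simp add: fp_right_act_def)
  define f where "f = (free_right_action S :: nat \<times> 'a \<Rightarrow> _)"
  have f [simp]: "f (x, s) t = (x, s \<otimes> t)" for x s t by (simp add: f_def free_right_action_def)
  have BA: "B \<subseteq> A" and B: "\<And>x s. x \<in> B \<Longrightarrow> s \<in> carrier S \<Longrightarrow> act x s \<in> B"
    using * by (auto simp: right_subact_def)
  have actB: "right_act S B act"
    by unfold_locales (use BA B act_one act_mult in auto)
  obtain X :: "nat set" and h where h: "presents S (X \<times> carrier S) f A act h"
    using * by (auto simp: fp_right_act_iff_presents[OF assms(1)] f_def)
  define F where "F = X \<times> carrier S"
  have onto: "h ` F = A"
    and hom: "\<And>x s. x \<in> F \<Longrightarrow> s \<in> carrier S \<Longrightarrow> h (f x s) = act (h x) s"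
    using h[folded F_def] by (simp_all add: presents_def)
  obtain R where R: "finite R" "R \<subseteq> kernel_on F h"
    and min: "\<forall>\<sigma>. right_congruence S F f \<sigma> \<and> R \<subseteq> \<sigma> \<longrightarrow> kernel_on F h \<subseteq> \<sigma>"
    using h[folded F_def] by (rule presentsE)
  have fF: "f P s \<in> F" if "P \<in> F" "s \<in> carrier S" for P s
    using that by (auto simp: F_def)
  have ff: "f (f P s) t = f P (s \<otimes> t)" if "snd P \<in> carrier S" "s \<in> carrier S" "t \<in> carrier S" for P s t
    using that by (cases P) (auto simp: m_assoc)
  have sndF: "snd P \<in> carrier S" if "P \<in> F" for P
    using that by (auto simp: F_def)
  obtain E where E: "finite E" "E \<subseteq> B" "B = (\<Union>x\<in>E. (\<lambda>s. act x s) ` carrier S)"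
    using * unfolding fg_right_act_def by blast
  \<comment> \<open>The generators of \<open>B\<close> are indexed by naturals because free
    generators must lie in \<nat>. An empty \<open>B\<close> gives \<open>n = 0\<close>.\<close>
  obtain n :: nat and e where e: "E = e ` {..<n}"
    using E(1) finite_imp_nat_seg_image_inj_on by (metis lessThan_def)
  define F' where "F' = {..<n} \<times> carrier S"
  define h' where "h' = (\<lambda>(i, s). act (e i) s)"
  have e_in: "e i \<in> B" "e i \<in> A" if "i < n" for i using that E(2) e BA by auto
  have onto': "h' ` F' = B"
    unfolding E(3) e by (force simp: h'_def F'_def)
  have fF': "f P s \<in> F'" if "P \<in> F'" "s \<in> carrier S" for P s
    using that by (auto simp: F'_def)
  have hom': "h' (f P s) = act (h' P) s" if "P \<in> F'" "s \<in> carrier S" for P s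
    using that e_in by (auto simp: F'_def h'_def act_mult)

  \<comment> \<open>For a free generator \<open>x\<close> of \<open>F\<close>, the \<open>s\<close>
    with \<open>h (x, s)\<close> in \<open>B\<close> form a right ideal: \<open>d\<close> is its
    free generator and \<open>c\<close> lifts \<open>h (x, d)\<close> to \<open>F'\<close>. All
    conclusions sit under the hypothesis on \<open>s\<close>, so an empty ideal leaves
    \<open>d\<close> and \<open>c\<close> arbitrary.\<close>
  have "\<exists>d c. \<forall>s\<in>carrier S. h (x, s) \<in> B \<longrightarrow> d \<in> carrier S \<and> c \<in> F' \<and> h' c = h (x, d) \<and>
      s \<in> (\<lambda>s. d \<otimes> s) ` carrier S \<and> inj_on (\<lambda>s. d \<otimes> s) (carrier S)" if "x \<in> X" for x
  proof (cases "\<exists>s\<in>carrier S. h (x, s) \<in> B")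
    case True
    define I where "I = {s \<in> carrier S. h (x, s) \<in> B}"
    have "s \<otimes> t \<in> I" if "s \<in> I" "t \<in> carrier S" for s t
      using that \<open>x \<in> X\<close> hom[of "(x, s)" t] B by (auto simp: I_def F_def)
    moreover have "I \<subseteq> carrier S" "I \<noteq> {}" using True by (auto simp: I_def)
    ultimately obtain d where d: "d \<in> I" "\<And>s. s \<in> I \<Longrightarrow> s \<in> (\<lambda>s. d \<otimes> s) ` carrier S"
      "inj_on (\<lambda>s. d \<otimes> s) (carrier S)"
      using free_right_idealsE[OF ideals, of I] by metis
    obtain c where "c \<in> F'" "h' c = h (x, d)"
      using d(1) imageE[of "h (x, d)" h' F'] onto' by (metis (mono_tags) I_def mem_Collect_eq)
    then show ?thesis using d by (intro exI[of _ d] exI[of _ c]) (simp add: I_def)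
  qed auto
  then obtain d c where dc: "\<And>x s. x \<in> X \<Longrightarrow> s \<in> carrier S \<Longrightarrow> h (x, s) \<in> B \<Longrightarrow>
      d x \<in> carrier S \<and> c x \<in> F' \<and> h' (c x) = h (x, d x) \<and>
      s \<in> (\<lambda>s. d x \<otimes> s) ` carrier S \<and> inj_on (\<lambda>s. d x \<otimes> s) (carrier S)"
    by metis
  \<comment> \<open>The preimage of \<open>B\<close> under \<open>h\<close> is free on the elements
    \<open>(x, d x)\<close>, so sending these to \<open>c x\<close> extends equivariantly:
    \<open>s = d x \<otimes> t\<close> with \<open>t\<close> unique, and \<open>inv_into\<close>
    extracts \<open>t\<close>. Outside the preimage the value is meaningless.\<close>
  define N where "N = (\<lambda>(x, s). f (c x) (inv_into (carrier S) (\<lambda>s. d x \<otimes> s) s))"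
  have N: "N P \<in> F'" "h' (N P) = h P" "\<And>u. u \<in> carrier S \<Longrightarrow> N (f P u) = f (N P) u"
    if PF: "P \<in> F" and hP: "h P \<in> B" for P
  proof -
    obtain x s where P: "P = (x, s)" and x: "x \<in> X" and s: "s \<in> carrier S"
      using PF by (auto simp: F_def)
    obtain t where t: "t \<in> carrier S" "s = d x \<otimes> t" using dc[OF x s] hP P by auto
    have *: "d x \<in> carrier S" "c x \<in> F'" "h' (c x) = h (x, d x)" "inj_on (\<lambda>s. d x \<otimes> s) (carrier S)"
      using dc[OF x s] hP P by auto
    have N_eq: "N (x, d x \<otimes> u) = f (c x) u" if "u \<in> carrier S" for u
      using inv_into_f_f[OF *(4) that] by (simp add: N_def)
    show "N P \<in> F'" using N_eq t P * fF' by auto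
    show "h' (N P) = h P"
      using N_eq[OF t(1)] t P * x hom[of "(x, d x)" t] hom' by (auto simp: F_def)
    show "N (f P u) = f (N P) u" if "u \<in> carrier S" for u
      using N_eq[OF t(1)] N_eq[of "t \<otimes> u"] that t P * ff[of "c x" t u]
      by (auto simp: m_assoc F'_def)
  qed

  \<comment> \<open>The same ideal argument for an arbitrary element \<open>P\<close> of
    \<open>F\<close>: every translate of \<open>P\<close> that enters \<open>B\<close> factors
    through \<open>f P k\<close>.\<close>
  have "\<exists>k. \<forall>s\<in>carrier S. h (f P s) \<in> B \<longrightarrow>
      k \<in> carrier S \<and> h (f P k) \<in> B \<and> s \<in> (\<lambda>s. k \<otimes> s) ` carrier S" if P: "P \<in> F" for P
  proof (cases "\<exists>s\<in>carrier S. h (f P s) \<in> B")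
    case True
    define I where "I = {s \<in> carrier S. h (f P s) \<in> B}"
    have "s \<otimes> t \<in> I" if "s \<in> I" "t \<in> carrier S" for s t
      using that P B hom[of "f P s" t] fF ff[OF sndF[OF P]] by (auto simp: I_def)
    moreover have "I \<subseteq> carrier S" "I \<noteq> {}" using True by (auto simp: I_def)
    ultimately obtain k where k: "k \<in> I" "\<And>s. s \<in> I \<Longrightarrow> s \<in> (\<lambda>s. k \<otimes> s) ` carrier S"
      using free_right_idealsE[OF ideals, of I] by metis
    then show ?thesis by (intro exI[of _ k]) (simp add: I_def)
  qed auto
  then obtain k where k: "\<And>P s. P \<in> F \<Longrightarrow> s \<in> carrier S \<Longrightarrow> h (f P s) \<in> B \<Longrightarrow>
      k P \<in> carrier S \<and> h (f P (k P)) \<in> B \<and> s \<in> (\<lambda>s. k P \<otimes> s) ` carrier S"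
    by metis
  have "\<exists>P\<in>F. h P = e i" if "i < n" for i
    using e_in[OF that] onto by (metis imageE)
  then obtain g where g: "\<And>i. i < n \<Longrightarrow> g i \<in> F \<and> h (g i) = e i" by metis

  \<comment> \<open>The filter keeps exactly the relations for which some translate enters
    \<open>B\<close>; for the others \<open>k P\<close> is unspecified. One \<open>k P\<close>
    serves both sides, since \<open>h P = h Q\<close> makes their translates enter \<open>B\<close>
    together.\<close>
  define R\<^sub>1 where "R\<^sub>1 = (\<lambda>(P, Q). (N (f P (k P)), N (f Q (k P)))) `
    {(P, Q) \<in> R. k P \<in> carrier S \<and> h (f P (k P)) \<in> B}"
  \<comment> \<open>These pairs identify each free generator of \<open>F'\<close> with a value of
    \<open>N\<close>, so that modulo them all of \<open>F'\<close> is reached by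
    \<open>N\<close>.\<close>
  define R\<^sub>2 where "R\<^sub>2 = (\<lambda>i. ((i, \<one>), N (g i))) ` {..<n}"
  have RF: "P \<in> F" "Q \<in> F" "h P = h Q" if "(P, Q) \<in> R" for P Q
    using that R(2) by (auto simp: kernel_on_def)
  have fin: "finite (R\<^sub>1 \<union> R\<^sub>2)"
    unfolding R\<^sub>1_def R\<^sub>2_def by (auto intro: finite_subset[OF _ R(1)])
  have "R\<^sub>1 \<subseteq> kernel_on F' h'"
  proof
    fix W assume "W \<in> R\<^sub>1"
    then obtain P Q where a: "(P, Q) \<in> R" "k P \<in> carrier S" "h (f P (k P)) \<in> B"
      and W: "W = (N (f P (k P)), N (f Q (k P)))"
      by (auto simp: R\<^sub>1_def)
    have "h (f Q (k P)) = h (f P (k P))" using hom RF[OF a(1)] a(2) by simp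
    then show "W \<in> kernel_on F' h'"
      using a RF[OF a(1)] N fF by (auto simp: W kernel_on_def)
  qed
  moreover have "R\<^sub>2 \<subseteq> kernel_on F' h'"
  proof -
    have "((i, \<one>), N (g i)) \<in> kernel_on F' h'" if "i < n" for i
    proof -
      have "N (g i) \<in> F'" "h' (N (g i)) = e i" using N(1,2)[of "g i"] g[OF that] e_in[OF that] by auto
      then show ?thesis using that e_in[OF that] by (simp add: kernel_on_def F'_def h'_def act_one)
    qed
    then show ?thesis by (auto simp: R\<^sub>2_def)
  qed
  moreover have "kernel_on F' h' \<subseteq> \<sigma>"
    if \<sigma>: "right_congruence S F' f \<sigma>" "R\<^sub>1 \<union> R\<^sub>2 \<subseteq> \<sigma>" for \<sigma>
  proof -
    have eq: "equiv F' \<sigma>" and \<sigma>act: "\<And>x y s. (x, y) \<in> \<sigma> \<Longrightarrow> s \<in> carrier S \<Longrightarrow> (f x s, f y s) \<in> \<sigma>"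
      using \<sigma>(1) by (auto simp: right_congruence_def)
    have \<sigma>refl: "(x, x) \<in> \<sigma>" if "x \<in> F'" for x using eq that by (auto simp: equiv_def refl_on_def)
    have \<sigma>sym: "(y, x) \<in> \<sigma>" if "(x, y) \<in> \<sigma>" for x y using eq that by (auto simp: equiv_def dest: symD)
    have \<sigma>trans: "(x, z) \<in> \<sigma>" if "(x, y) \<in> \<sigma>" "(y, z) \<in> \<sigma>" for x y z
      using eq that by (auto simp: equiv_def dest: transD)
    \<comment> \<open>The pullback of \<open>\<sigma>\<close> along \<open>N\<close>, made into a
      congruence on all of \<open>F\<close>: quantifying over \<open>s\<close> gives stability under
      the action, and the equivalence of memberships is needed for transitivity because
      \<open>N\<close> is meaningful only over \<open>B\<close>.\<close>
    define \<tau> where "\<tau> = {(P, Q) \<in> F \<times> F. \<forall>s\<in>carrier S. (h (f P s) \<in> B \<longleftrightarrow> h (f Q s) \<in> B) \<and>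
      (h (f P s) \<in> B \<longrightarrow> (N (f P s), N (f Q s)) \<in> \<sigma>)}"
    have "equiv F \<tau>"
    proof (intro equivI refl_onI symI transI)
      show "\<tau> \<subseteq> F \<times> F" by (auto simp: \<tau>_def)
      show "(P, P) \<in> \<tau>" if "P \<in> F" for P
        using that fF N(1) \<sigma>refl by (auto simp: \<tau>_def)
      show "(Q, P) \<in> \<tau>" if "(P, Q) \<in> \<tau>" for P Q
        using that \<sigma>sym by (auto simp: \<tau>_def)
      show "(P, U) \<in> \<tau>" if "(P, Q) \<in> \<tau>" "(Q, U) \<in> \<tau>" for P Q U
        using that \<sigma>trans[of "N (f P _)" "N (f Q _)" "N (f U _)"] by (auto simp: \<tau>_def)
    qed
    moreover have "(f P s, f Q s) \<in> \<tau>" if PQ: "(P, Q) \<in> \<tau>" and s: "s \<in> carrier S" for P Q s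
    proof -
      have "P \<in> F" "Q \<in> F" using PQ by (auto simp: \<tau>_def)
      then have "f P s \<in> F" "f Q s \<in> F" "\<And>t. t \<in> carrier S \<Longrightarrow> f (f P s) t = f P (s \<otimes> t)"
        "\<And>t. t \<in> carrier S \<Longrightarrow> f (f Q s) t = f Q (s \<otimes> t)"
        using s fF ff sndF by auto
      then show ?thesis using PQ s by (auto simp: \<tau>_def)
    qed
    ultimately have "right_congruence S F f \<tau>" by (auto simp: right_congruence_def)
    moreover have "R \<subseteq> \<tau>"
    proof clarify
      fix P Q assume PQ: "(P, Q) \<in> R"
      note PF = RF(1)[OF PQ] and QF = RF(2)[OF PQ]
      have heq: "h (f P s) = h (f Q s)" if "s \<in> carrier S" for s
        using that hom PF QF RF(3)[OF PQ] by simp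
      have "(N (f P s), N (f Q s)) \<in> \<sigma>" if s: "s \<in> carrier S" and hB: "h (f P s) \<in> B" for s
      proof -
        obtain t where t: "t \<in> carrier S" "s = k P \<otimes> t" and kP: "k P \<in> carrier S" "h (f P (k P)) \<in> B"
          using k[OF PF s hB] by auto
        \<comment> \<open>At \<open>k P\<close> the pair is in \<open>R\<^sub>1\<close>; acting by
          \<open>t\<close> and using equivariance of \<open>N\<close> reaches every translate in
          \<open>B\<close>.\<close>
        have "(N (f P (k P)), N (f Q (k P))) \<in> \<sigma>"
          using PQ kP \<sigma>(2) by (force simp: R\<^sub>1_def)
        then have "(f (N (f P (k P))) t, f (N (f Q (k P))) t) \<in> \<sigma>" using \<sigma>act t(1) by simp
        moreover have "f (N (f P (k P))) t = N (f P s)"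
          using N(3)[OF fF[OF PF kP(1)] kP(2) t(1)] ff[OF sndF[OF PF] kP(1) t(1)] t(2) by simp
        moreover have "f (N (f Q (k P))) t = N (f Q s)"
          using N(3)[OF fF[OF QF kP(1)] _ t(1)] kP(2) heq[OF kP(1)]
            ff[OF sndF[OF QF] kP(1) t(1)] t(2) by simp
        ultimately show ?thesis by simp
      qed
      then show "(P, Q) \<in> \<tau>" using PF QF heq by (auto simp: \<tau>_def)
    qed
    ultimately have ker: "kernel_on F h \<subseteq> \<tau>" using min by simp
    \<comment> \<open>Equivariance spreads \<open>R\<^sub>2\<close> from the generators to all of
      \<open>F'\<close>.\<close>
    have lift: "(f (i, \<one>) s, N (f (g i) s)) \<in> \<sigma>" if "i < n" "s \<in> carrier S" for i s
    proof -
      have "((i, \<one>), N (g i)) \<in> \<sigma>" using that \<sigma>(2) by (auto simp: R\<^sub>2_def)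
      then have "(f (i, \<one>) s, f (N (g i)) s) \<in> \<sigma>" using that(2) by (rule \<sigma>act)
      moreover have "N (f (g i) s) = f (N (g i)) s"
        using g[OF that(1)] e_in[OF that(1)] that(2) by (intro N(3)) simp_all
      ultimately show ?thesis by simp
    qed
    \<comment> \<open>The chain is \<open>(i, s)\<close>, \<open>N (f (g i) s)\<close>,
      \<open>N (f (g j) t)\<close>, \<open>(j, t)\<close>: the outer links come from
      \<open>lift\<close>, the middle one from \<open>\<tau>\<close> at the translate by
      \<open>\<one>\<close>.\<close>
    show ?thesis
    proof clarify
      fix i s j t assume "((i, s), (j, t)) \<in> kernel_on F' h'"
      then have a: "(i, s) \<in> F'" "(j, t) \<in> F'" "h' (i, s) = h' (j, t)" by (auto simp: kernel_on_def)
      then have ij: "i < n" "s \<in> carrier S" "j < n" "t \<in> carrier S" by (auto simp: F'_def)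
      then have eqs: "h (f (g i) s) = act (e i) s" "h (f (g j) t) = act (e j) t"
        using hom g by auto
      then have "(f (g i) s, f (g j) t) \<in> kernel_on F h"
        using a(3) fF g ij by (simp add: h'_def kernel_on_def)
      then have "(f (g i) s, f (g j) t) \<in> \<tau>" using ker by blast
      moreover have "f (f (g i) s) \<one> = f (g i) s" "f (f (g j) t) \<one> = f (g j) t"
        using ij g sndF by (auto simp: ff)
      moreover have "h (f (g i) s) \<in> B" using eqs(1) B e_in(1) ij by simp
      ultimately have "(N (f (g i) s), N (f (g j) t)) \<in> \<sigma>"
        unfolding \<tau>_def by (auto dest: bspec[of _ _ "\<one>"])
      moreover have "((i, s), N (f (g i) s)) \<in> \<sigma>" "(N (f (g j) t), (j, t)) \<in> \<sigma>"
        using lift[OF ij(1,2)] lift[OF ij(3,4), THEN \<sigma>sym] ij by simp_all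
      ultimately show "((i, s), (j, t)) \<in> \<sigma>" by (blast intro: \<sigma>trans)
    qed
  qed
  ultimately have "presents S F' f B act h'"
    using onto' hom' fin by (intro presentsI[where R = "R\<^sub>1 \<union> R\<^sub>2"]) simp_all
  then show "fp_right_act S B act"
    unfolding fp_right_act_iff_presents[OF assms(1)] F'_def f_def
    using actB by (intro conjI exI[of _ "{..<n}"] exI[of _ h']) simp_all
qed

section \<open>One-sided ideals of the Bruck--Reilly extension of a group\<close>

lemma hom_funpow_one:
  assumes "group G" and "\<theta> \<in> hom G G"
  shows "(\<theta> ^^ n) \<one>\<^bsub>G\<^esub> = \<one>\<^bsub>G\<^esub>"
  using hom_one[OF assms(2,1,1)] by (induction n) auto

text \<open>Left multiplication by \<open>(n, 1, 0)\<close> adds \<open>n\<close> to the first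
  coordinate and changes nothing else. It is thus injective, with image all triples of first
  coordinate at least \<open>n\<close>.\<close>

lemma free_right_ideals_Bruck_Reilly:
  assumes "group G" and "\<theta> \<in> hom G G"
  shows "free_right_ideals (Bruck_Reilly G \<theta>)"
  unfolding free_right_ideals_def
proof (intro allI impI, elim conjE)
  interpret group G by fact
  let ?S = "Bruck_Reilly G \<theta>"
  fix I assume sub: "I \<subseteq> carrier ?S" and "I \<noteq> {}" and ideal: "\<forall>x\<in>I. \<forall>s\<in>carrier ?S. x \<otimes>\<^bsub>?S\<^esub> s \<in> I"
  define n where "n = (LEAST n. n \<in> fst ` I)"
  have "n \<in> fst ` I" unfolding n_def by (rule LeastI_ex) (use \<open>I \<noteq> {}\<close> in blast)
  then obtain g b where gb: "(n, g, b) \<in> I" by force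
  then have g: "g \<in> carrier G" using sub by (auto simp: Bruck_Reilly_def)
  have mult: "(n, \<one>\<^bsub>G\<^esub>, 0) \<otimes>\<^bsub>?S\<^esub> s = (n + fst s, snd s)" if "s \<in> carrier ?S" for s
    using that by (auto simp: Bruck_Reilly_def hom_funpow_one[OF assms])
  \<comment> \<open>With equal inner coordinates no power of \<open>\<theta>\<close> intervenes, so
    the group inverse clears the middle entry and brings the generator into
    \<open>I\<close>.\<close>
  have "(n, g, b) \<otimes>\<^bsub>?S\<^esub> (b, inv\<^bsub>G\<^esub> g, 0) = (n, \<one>\<^bsub>G\<^esub>, 0)"
    using g by (simp add: Bruck_Reilly_def)
  moreover have "(b, inv\<^bsub>G\<^esub> g, 0) \<in> carrier ?S" using g by (simp add: Bruck_Reilly_def)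
  ultimately have d: "(n, \<one>\<^bsub>G\<^esub>, 0) \<in> I" using ideal gb by metis
  moreover have "I = (\<lambda>s. (n, \<one>\<^bsub>G\<^esub>, 0) \<otimes>\<^bsub>?S\<^esub> s) ` carrier ?S"
  proof
    show "I \<subseteq> (\<lambda>s. (n, \<one>\<^bsub>G\<^esub>, 0) \<otimes>\<^bsub>?S\<^esub> s) ` carrier ?S"
    proof
      fix s assume s: "s \<in> I"
      \<comment> \<open>Minimality of \<open>n\<close> makes the truncated subtraction
        \<open>fst s - n\<close> exact.\<close>
      then have "n \<le> fst s" unfolding n_def by (intro Least_le) auto
      moreover have c: "(fst s - n, snd s) \<in> carrier ?S" using s sub by (auto simp: Bruck_Reilly_def)
      ultimately have "s = (n, \<one>\<^bsub>G\<^esub>, 0) \<otimes>\<^bsub>?S\<^esub> (fst s - n, snd s)" using mult by simp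
      then show "s \<in> (\<lambda>s. (n, \<one>\<^bsub>G\<^esub>, 0) \<otimes>\<^bsub>?S\<^esub> s) ` carrier ?S" using c by blast
    qed
  qed (use ideal d in blast)
  moreover have "inj_on (\<lambda>s. (n, \<one>\<^bsub>G\<^esub>, 0) \<otimes>\<^bsub>?S\<^esub> s) (carrier ?S)"
    using mult by (auto simp: inj_on_def)
  ultimately show "\<exists>d\<in>I. I = (\<lambda>s. d \<otimes>\<^bsub>?S\<^esub> s) ` carrier ?S \<and> inj_on (\<lambda>s. d \<otimes>\<^bsub>?S\<^esub> s) (carrier ?S)"
    by blast
qed

text \<open>The mirror image: \<open>I\<close> is a left ideal of the extension itself, and right
  multiplication by \<open>(0, 1, n)\<close> adds \<open>n\<close> to the last coordinate
  only.\<close>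

lemma free_right_ideals_opposite_Bruck_Reilly:
  assumes "group G" and "\<theta> \<in> hom G G"
  shows "free_right_ideals (opposite (Bruck_Reilly G \<theta>))"
  unfolding free_right_ideals_def opposite_simps
proof (intro allI impI, elim conjE)
  interpret group G by fact
  let ?S = "Bruck_Reilly G \<theta>" and ?last = "\<lambda>s :: nat \<times> 'a \<times> nat. snd (snd s)"
  fix I assume sub: "I \<subseteq> carrier ?S" and "I \<noteq> {}" and ideal: "\<forall>x\<in>I. \<forall>s\<in>carrier ?S. s \<otimes>\<^bsub>?S\<^esub> x \<in> I"
  define n where "n = (LEAST n. n \<in> ?last ` I)"
  have "n \<in> ?last ` I" unfolding n_def by (rule LeastI_ex) (use \<open>I \<noteq> {}\<close> in blast)
  then obtain a g where ag: "(a, g, n) \<in> I" by force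
  then have g: "g \<in> carrier G" using sub by (auto simp: Bruck_Reilly_def)
  have mult: "s \<otimes>\<^bsub>?S\<^esub> (0, \<one>\<^bsub>G\<^esub>, n) = (fst s, fst (snd s), n + ?last s)" if "s \<in> carrier ?S" for s
    using that by (auto simp: Bruck_Reilly_def hom_funpow_one[OF assms])
  have "(0, inv\<^bsub>G\<^esub> g, a) \<otimes>\<^bsub>?S\<^esub> (a, g, n) = (0, \<one>\<^bsub>G\<^esub>, n)"
    using g by (simp add: Bruck_Reilly_def)
  moreover have "(0, inv\<^bsub>G\<^esub> g, a) \<in> carrier ?S" using g by (simp add: Bruck_Reilly_def)
  ultimately have d: "(0, \<one>\<^bsub>G\<^esub>, n) \<in> I" using ideal ag by metis
  moreover have "I = (\<lambda>s. s \<otimes>\<^bsub>?S\<^esub> (0, \<one>\<^bsub>G\<^esub>, n)) ` carrier ?S"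
  proof
    show "I \<subseteq> (\<lambda>s. s \<otimes>\<^bsub>?S\<^esub> (0, \<one>\<^bsub>G\<^esub>, n)) ` carrier ?S"
    proof
      fix s assume s: "s \<in> I"
      let ?t = "(fst s, fst (snd s), ?last s - n)"
      have "n \<le> ?last s" unfolding n_def using s by (intro Least_le) auto
      moreover have c: "?t \<in> carrier ?S" using s sub by (auto simp: Bruck_Reilly_def)
      ultimately have "s = ?t \<otimes>\<^bsub>?S\<^esub> (0, \<one>\<^bsub>G\<^esub>, n)" using mult by simp
      then show "s \<in> (\<lambda>s. s \<otimes>\<^bsub>?S\<^esub> (0, \<one>\<^bsub>G\<^esub>, n)) ` carrier ?S" using c by blast
    qed
  qed (use ideal d in blast)
  moreover have "inj_on (\<lambda>s. s \<otimes>\<^bsub>?S\<^esub> (0, \<one>\<^bsub>G\<^esub>, n)) (carrier ?S)"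
    using mult by (auto simp: inj_on_def)
  ultimately show "\<exists>d\<in>I. I = (\<lambda>s. s \<otimes>\<^bsub>?S\<^esub> d) ` carrier ?S \<and> inj_on (\<lambda>s. s \<otimes>\<^bsub>?S\<^esub> d) (carrier ?S)"
    by blast
qed

theorem corollary3p4:
  fixes G :: "('g, 'm) monoid_scheme" and \<theta> :: "'g \<Rightarrow> 'g"
  assumes "group G" and "\<theta> \<in> hom G G"
  shows "right_coherent TYPE('x) (Bruck_Reilly G \<theta>) \<and> left_coherent TYPE('y) (Bruck_Reilly G \<theta>)"
proof -
  \<comment> \<open>Membership in \<open>hom\<close> speaks only of products; that
    \<open>\<theta>\<close> fixes the identity follows because \<open>G\<close> is a group.\<close>
  have M: "monoid (Bruck_Reilly G \<theta>)"
    using assms hom_one[OF assms(2,1,1)] by (intro monoid_Bruck_Reilly) (auto simp: group.is_monoid)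
  show ?thesis
  proof
    show "right_coherent TYPE('x) (Bruck_Reilly G \<theta>)"
      by (intro right_coherent_if_free_right_ideals M free_right_ideals_Bruck_Reilly assms)
    show "left_coherent TYPE('y) (Bruck_Reilly G \<theta>)"
      by (intro left_coherent_if_opposite right_coherent_if_free_right_ideals monoid_opposite M
          free_right_ideals_opposite_Bruck_Reilly assms)
  qed
qed

end
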